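(* Let $a$ and $a'$ be autoregressive language models over a finite vocabulary $V$, viewed as probability distributions on $\mathcal{Y} = V^*$, and let $b : \mathcal{Y} \to \{0,1\}$ be a binary constraint. Assume that $Z = \sum_{y\in\mathcal{Y}} a(y)\,b(y) > 0$ and that there exists at least one $y\in\mathcal{Y}$ with $a'(y)>0$ and $b(y)=1$. Let $g(y) = \frac{1}{Z}a(y)\,b(y)$ be the gold model, let $g'$ be the distribution of the output of the rejection sampler with proposal $a'$ and constraint $b$, and let $AR_{a'} = \mathbb{E}_{y\sim a'}\, b(y)$ be its acceptance rate. Then $$\mathrm{KL}(g\|a') = \mathrm{KL}(g\|g') + \mathrm{KL}(g'\|a') = \mathrm{KL}(g\|g') - \log AR_{a'}.$$
   Context: $V^*$ is the (countable) set of finite sequences over $V$. The rejection sampler with proposal $a'$ and constraint $b$ is the following procedure: sample $y$ independently from $a'$ repeatedly until $b(y)=1$, then return this $y$. The acceptance rate $AR_{a'}$ is the probability that a single sample from $a'$ satisfies $b(y)=1$. For probability distributions $p,q$ on $\mathcal{Y}$, $\mathrm{KL}(p\|q) = \mathbb{E}_{y\sim p}\log\frac{p(y)}{q(y)} \in [0,\infty]$ is the Kullback–Leibler divergence, with the usual conventions ($0\log 0 = 0$, and value $+\infty$ if $p(y)>0=q(y)$ for some $y$); the equalities are understood in $[0,\infty]$. *)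

theory Defs
  imports "HOL-Probability.Probability"
begin

(* The set of all token sequences is 'v list, with the vocabulary a finite type 'v.  A model is given
   by its conditional next-token distributions: nxt x is the distribution of the next token after the
   prefix x, where None is the end-of-sequence symbol.  That p is a pmf means that no probability
   mass is lost to infinite sequences. *)
definition autoregressive :: "'v list pmf \<Rightarrow> bool" where
  "autoregressive p \<longleftrightarrow>
     (\<exists>nxt :: 'v list \<Rightarrow> 'v option pmf. \<forall>y.
        pmf p y = (\<Prod>i<length y. pmf (nxt (take i y)) (Some (y ! i))) * pmf (nxt y) None)"

definition gold_normalizer :: "'a pmf \<Rightarrow> ('a \<Rightarrow> bool) \<Rightarrow> real" where
  "gold_normalizer a b = (\<Sum>\<^sub>\<infinity>y. pmf a y * of_bool (b y))"

(* Only meaningful if the normalizer is positive, see pmf_gold_model below. *)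
definition gold_model :: "'a pmf \<Rightarrow> ('a \<Rightarrow> bool) \<Rightarrow> 'a pmf" where
  "gold_model a b = embed_pmf (\<lambda>y. 1 / gold_normalizer a b * pmf a y * of_bool (b y))"

definition acceptance_rate :: "'a pmf \<Rightarrow> ('a \<Rightarrow> bool) \<Rightarrow> real" where
  "acceptance_rate a b = measure_pmf.expectation a (\<lambda>y. of_bool (b y))"

(* The run of the sampler on the sequence \<omega> of proposed samples: the first accepted one.
   The value is arbitrary if no proposal is ever accepted. *)
definition rejection_output :: "('a \<Rightarrow> bool) \<Rightarrow> 'a stream \<Rightarrow> 'a" where
  "rejection_output b \<omega> = \<omega> !! (LEAST n. b (\<omega> !! n))"

(* stream_space (measure_pmf a) is the law of an i.i.d. sequence of samples from a. *)
definition rejection_sampler :: "'a pmf \<Rightarrow> ('a \<Rightarrow> bool) \<Rightarrow> 'a pmf" where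
  "rejection_sampler a b =
     Abs_pmf (distr (stream_space (measure_pmf a)) (count_space UNIV) (rejection_output b))"

(* The expectation of the log-ratio under p, as positive part minus negative part (ennreal truncates
   negative reals to 0); the negative part is always finite, see kl_div_neg_part_le_1.  The
   library's real-valued KL_divergence cannot express the value \<infinity>. *)
definition kl_div :: "'a pmf \<Rightarrow> 'a pmf \<Rightarrow> ereal" where
  "kl_div p q =
     (if \<exists>y. pmf p y > 0 \<and> pmf q y = 0 then \<infinity>
      else enn2ereal (\<integral>\<^sup>+y. ennreal (ln (pmf p y / pmf q y)) \<partial>measure_pmf p)
         - enn2ereal (\<integral>\<^sup>+y. ennreal (- ln (pmf p y / pmf q y)) \<partial>measure_pmf p))"

lemma gold_normalizer_has_sum:
  "((\<lambda>y. pmf a y * of_bool (b y)) has_sum gold_normalizer a b) UNIV"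
proof -
  have "(\<lambda>y. pmf a y * of_bool (b y)) summable_on UNIV"
  proof (rule summable_on_comparison_test)
    show "pmf a summable_on UNIV"
      using pmf_abs_summable[of a UNIV]
      by (simp add: abs_summable_equivalent[symmetric])
  qed auto
  then show ?thesis unfolding gold_normalizer_def by (rule has_sum_infsum)
qed

lemma pmf_gold_model:
  assumes "gold_normalizer a b > 0"
  shows "pmf (gold_model a b) y = 1 / gold_normalizer a b * pmf a y * of_bool (b y)"
proof -
  let ?Z = "gold_normalizer a b" and ?h = "\<lambda>y. pmf a y * of_bool (b y)"
  let ?f = "\<lambda>y. 1 / ?Z * pmf a y * of_bool (b y)"
  have hs: "(?f has_sum 1) UNIV"
    using has_sum_cmult_right[OF gold_normalizer_has_sum[of a b], of "1 / ?Z"] assms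
    by (simp add: mult.assoc)
  have "(\<integral>\<^sup>+y. ennreal (?f y) \<partial>count_space UNIV) = 1"
  proof -
    have "?f summable_on UNIV" using hs by (rule has_sum_imp_summable)
    then have "(\<lambda>y. norm (?f y)) summable_on UNIV"
      by (rule summable_on_iff_abs_summable_on_real[THEN iffD1])
    then have abs: "Infinite_Set_Sum.abs_summable_on ?f UNIV"
      by (simp only: abs_summable_equivalent)
    have "infsetsum ?f UNIV = 1"
      using infsetsum_infsum[OF abs] infsumI[OF hs] by simp
    then show ?thesis
      using nn_integral_conv_infsetsum[OF abs] assms by simp
  qed
  then show ?thesis unfolding gold_model_def
    using assms by (intro pmf_embed_pmf) auto
qed

lemma measure_pmf_rejection_sampler:
  fixes a :: "'a :: countable pmf"
  shows "measure_pmf (rejection_sampler a b) =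
    distr (stream_space (measure_pmf a)) (count_space UNIV) (rejection_output b)"
proof -
  let ?S = "stream_space (measure_pmf a)"
  let ?D = "distr ?S (count_space UNIV) (rejection_output b)"
  have snth: "(\<lambda>\<omega>. \<omega> !! n) \<in> measurable ?S (count_space UNIV)" for n
    using measurable_snth[of n "measure_pmf a"] by (simp cong: measurable_cong_sets)
  have [measurable]: "Measurable.pred ?S (\<lambda>\<omega>. b (\<omega> !! n))" for n
    using measurable_compose[OF snth] by simp
  have "(\<lambda>\<omega>. LEAST n. b (\<omega> !! n)) \<in> measurable ?S (count_space UNIV)"
    by measurable
  then have meas: "rejection_output b \<in> measurable ?S (count_space UNIV)"
    unfolding rejection_output_def by (rule measurable_compose_countable[OF snth])
  interpret prob_space ?S
    by (rule prob_space.prob_space_stream_space) (rule prob_space_measure_pmf)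
  interpret D: prob_space ?D by (rule prob_space_distr[OF meas])
  have "AE x in ?D. measure ?D {x} \<noteq> 0"
    by (subst D.AE_support_countable) (auto intro!: exI[of _ UNIV])
  then show ?thesis unfolding rejection_sampler_def
    by (intro Abs_pmf_inverse) (auto intro: D.prob_space_axioms)
qed

lemma nn_integral_pmf_ratio_le_1:
  "(\<integral>\<^sup>+y. ennreal (pmf q y / pmf p y) \<partial>measure_pmf p) \<le> 1"
proof -
  have "(\<integral>\<^sup>+y. ennreal (pmf q y / pmf p y) \<partial>measure_pmf p)
      = (\<integral>\<^sup>+y. ennreal (pmf p y) * ennreal (pmf q y / pmf p y) \<partial>count_space UNIV)"
    by (simp add: nn_integral_measure_pmf)
  also have "\<dots> \<le> (\<integral>\<^sup>+y. ennreal (pmf q y) \<partial>count_space UNIV)"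
    by (intro nn_integral_mono) (auto simp: ennreal_mult[symmetric])
  also have "\<dots> = 1" by (simp add: nn_integral_pmf)
  finally show ?thesis .
qed

lemma kl_div_parts_le:
  assumes "\<And>y. pmf p y > 0 \<Longrightarrow> pmf q y \<noteq> 0"
  shows "(\<integral>\<^sup>+y. ennreal (- ln (pmf p y / pmf q y)) \<partial>measure_pmf p) + 1
    \<le> 1 + (\<integral>\<^sup>+y. ennreal (ln (pmf p y / pmf q y)) \<partial>measure_pmf p)"
proof -
  have pt: "ennreal (- ln (pmf p y / pmf q y)) + 1
      \<le> ennreal (pmf q y / pmf p y) + ennreal (ln (pmf p y / pmf q y))" if "y \<in> set_pmf p" for y
  proof -
    have pos: "pmf p y > 0" "pmf q y > 0"
      using pmf_positive[OF that] assms[of y] by (simp_all add: less_le)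
    define r where "r = pmf q y / pmf p y"
    have r: "r > 0" "- ln (pmf p y / pmf q y) = ln r" "ln (pmf p y / pmf q y) = - ln r"
      using pos by (simp_all add: r_def ln_div)
    have "ln r \<le> r - 1" using r(1) by (rule ln_le_minus_one)
    then have "max 0 (ln r) + 1 \<le> r + max 0 (- ln r)" by linarith
    then have "ennreal (max 0 (ln r) + 1) \<le> ennreal (r + max 0 (- ln r))"
      by (rule ennreal_leI)
    then show ?thesis
      using r unfolding r(2,3) r_def[symmetric]
      by (simp add: ennreal_plus max_def ennreal_neg split: if_splits)
  qed
  have "(\<integral>\<^sup>+y. ennreal (- ln (pmf p y / pmf q y)) \<partial>measure_pmf p) + 1
      = (\<integral>\<^sup>+y. ennreal (- ln (pmf p y / pmf q y)) + 1 \<partial>measure_pmf p)"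
    by (subst nn_integral_add) auto
  also have "\<dots> \<le> (\<integral>\<^sup>+y. ennreal (pmf q y / pmf p y) + ennreal (ln (pmf p y / pmf q y)) \<partial>measure_pmf p)"
    using pt by (intro nn_integral_mono_AE) (auto simp: AE_measure_pmf_iff)
  also have "\<dots> = (\<integral>\<^sup>+y. ennreal (pmf q y / pmf p y) \<partial>measure_pmf p)
      + (\<integral>\<^sup>+y. ennreal (ln (pmf p y / pmf q y)) \<partial>measure_pmf p)"
    by (subst nn_integral_add) auto
  also have "\<dots> \<le> 1 + (\<integral>\<^sup>+y. ennreal (ln (pmf p y / pmf q y)) \<partial>measure_pmf p)"
    by (intro add_right_mono nn_integral_pmf_ratio_le_1)
  finally show ?thesis .
qed

lemma kl_div_neg_part_le_1:
  assumes "\<And>y. pmf p y > 0 \<Longrightarrow> pmf q y \<noteq> 0"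
  shows "(\<integral>\<^sup>+y. ennreal (- ln (pmf p y / pmf q y)) \<partial>measure_pmf p) \<le> 1"
proof -
  have "ennreal (- ln (pmf p y / pmf q y)) \<le> ennreal (pmf q y / pmf p y)" if "y \<in> set_pmf p" for y
  proof -
    have pos: "pmf p y > 0" "pmf q y > 0"
      using pmf_positive[OF that] assms[of y] by (simp_all add: less_le)
    then show ?thesis
      using ln_le_minus_one[of "pmf q y / pmf p y"] by (intro ennreal_leI) (simp add: ln_div)
  qed
  then have "(\<integral>\<^sup>+y. ennreal (- ln (pmf p y / pmf q y)) \<partial>measure_pmf p)
      \<le> (\<integral>\<^sup>+y. ennreal (pmf q y / pmf p y) \<partial>measure_pmf p)"
    by (intro nn_integral_mono_AE) (auto simp: AE_measure_pmf_iff)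
  also have "\<dots> \<le> 1" by (rule nn_integral_pmf_ratio_le_1)
  finally show ?thesis .
qed

lemma kl_div_nonneg: "kl_div p q \<ge> 0"
proof (cases "\<exists>y. pmf p y > 0 \<and> pmf q y = 0")
  case False
  then have *: "\<And>y. pmf p y > 0 \<Longrightarrow> pmf q y \<noteq> 0" by auto
  let ?N = "\<integral>\<^sup>+y. ennreal (- ln (pmf p y / pmf q y)) \<partial>measure_pmf p"
  let ?P = "\<integral>\<^sup>+y. ennreal (ln (pmf p y / pmf q y)) \<partial>measure_pmf p"
  have "1 + ?N \<le> 1 + ?P" using kl_div_parts_le[OF *] by (simp add: add.commute)
  then have le: "?N \<le> ?P" by (subst (asm) ennreal_add_left_cancel_le) auto
  have "?N < \<top>" by (rule order_le_less_trans[OF kl_div_neg_part_le_1[OF *]]) auto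
  then have "\<bar>enn2ereal ?N\<bar> \<noteq> \<infinity>"
    by (cases ?N) (auto simp: enn2ereal_ennreal)
  moreover have "enn2ereal ?N \<le> enn2ereal ?P" using le by (simp add: less_eq_ennreal.rep_eq)
  ultimately have "0 \<le> enn2ereal ?P - enn2ereal ?N" by (simp add: ereal_diff_positive)
  then show ?thesis unfolding kl_div_def using False by auto
qed (simp add: kl_div_def)

end

theory Submission
  imports Defs
begin

text \<open>Conditioning on the first proposal shows that the probability \<open>q\<close> that the sampler outputs an
  accepted \<open>y\<close> satisfies \<open>q = a' y + (1 - AR) q\<close>, so \<open>g'\<close> is \<open>a'\<close> restricted to \<open>b\<close> and
  rescaled by \<open>1 / AR\<close>. On the support of \<open>g\<close>, and on that of \<open>g'\<close>, the log-ratios against \<open>a'\<close>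
  and against \<open>g'\<close> therefore differ by the constant \<open>- ln AR\<close>.\<close>

lemma acceptance_rate_eq_measure: "acceptance_rate a b = measure_pmf.prob a {y. b y}"
proof -
  have "(\<lambda>y. of_bool (b y)) = (indicator {y. b y} :: _ \<Rightarrow> real)"
    by (auto simp: indicator_def)
  then show ?thesis by (simp add: acceptance_rate_def)
qed

lemma acceptance_rate_le_1: "acceptance_rate a b \<le> 1"
  by (simp add: acceptance_rate_eq_measure)

lemma acceptance_rate_pos:
  assumes "pmf a y > 0" "b y"
  shows "acceptance_rate a b > 0"
proof -
  have "pmf a y \<le> measure_pmf.prob a {y. b y}"
    unfolding pmf.rep_eq using assms by (intro measure_pmf.finite_measure_mono) auto
  then show ?thesis using assms by (simp add: acceptance_rate_eq_measure)
qed

lemma measurable_snth_pmf [measurable]: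
  "(\<lambda>\<omega>. \<omega> !! n) \<in> measurable (stream_space (measure_pmf a)) (count_space UNIV)"
  using measurable_snth[of n "measure_pmf a"] by (simp cong: measurable_cong_sets)

lemma measurable_accepted [measurable]:
  "Measurable.pred (stream_space (measure_pmf a)) (\<lambda>\<omega>. b (\<omega> !! n))"
  using measurable_compose[OF measurable_snth_pmf[of n a], of b "count_space UNIV"] by simp

text \<open>The stopping index is random but takes only countably many values, so measurability
  reduces to that of each fixed coordinate.\<close>

lemma measurable_rejection_output [measurable]:
  "rejection_output b \<in> measurable (stream_space (measure_pmf a)) (count_space UNIV)"
proof -
  have "(\<lambda>\<omega>. LEAST n. b (\<omega> !! n)) \<in> measurable (stream_space (measure_pmf a)) (count_space UNIV)"
    by measurable
  then show ?thesis
    unfolding rejection_output_def by (rule measurable_compose_countable[OF measurable_snth_pmf])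
qed

lemma rejection_output_accept: "b x \<Longrightarrow> rejection_output b (x ## \<omega>) = x"
  unfolding rejection_output_def by (subst Least_eq_0) auto

text \<open>The index of the first accepted proposal shifts by one. \<open>LEAST\<close> obeys this
  shift once its predicate has a witness, which the accepted sample in the tail supplies.\<close>

lemma rejection_output_reject:
  assumes "\<not> b x" "b (\<omega> !! n)"
  shows "rejection_output b (x ## \<omega>) = rejection_output b \<omega>"
proof -
  have "(LEAST n. b ((x ## \<omega>) !! n)) = Suc (LEAST n. b ((x ## \<omega>) !! Suc n))"
    by (rule Least_Suc[of _ "Suc n"]) (use assms in auto)
  then show ?thesis by (simp add: rejection_output_def)
qed

text \<open>In \<open>ennreal\<close>, subtracting \<open>(1 - r) * q\<close> from both sides is
  sound only for finite \<open>q\<close>. The bound \<open>q \<le> 1\<close> makes \<open>q\<close>,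
  and hence \<open>c\<close>, real, and the equation is solved there.\<close>

lemma first_step_fixpoint:
  fixes c q :: ennreal
  assumes "q = c + ennreal (1 - r) * q" "q \<le> 1" "0 < r" "r \<le> 1"
  shows "ennreal r * q = c"
proof -
  obtain q' where q': "q = ennreal q'" "q' \<ge> 0"
    using assms(2) by (cases q) (auto simp: top_unique)
  have "c \<le> q" using assms(1) by (metis le_iff_add)
  then obtain c' where c': "c = ennreal c'" "c' \<ge> 0"
    using q' by (cases c) (auto simp: top_unique)
  have "ennreal q' = ennreal (c' + (1 - r) * q')"
    using assms q' c' by (simp add: ennreal_mult)
  then have "q' = c' + (1 - r) * q'"
    using assms q' c' by (subst (asm) ennreal_inj) auto
  then have "r * q' = c'" by (simp add: algebra_simps)
  then show ?thesis
    unfolding q'(1) c'(1) using q'(2) assms(3) by (simp add: ennreal_mult[symmetric])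
qed

lemma emeasure_rejected:
  "emeasure (measure_pmf a) {y. \<not> b y} = ennreal (1 - acceptance_rate a b)"
proof -
  have "measure_pmf.prob a (UNIV - {y. b y}) = 1 - measure_pmf.prob a {y. b y}"
    using measure_pmf.prob_compl[of "{y. b y}" a] by simp
  moreover have "UNIV - {y. b y} = {y. \<not> b y}" by auto
  ultimately show ?thesis
    by (simp add: measure_pmf.emeasure_eq_measure acceptance_rate_eq_measure)
qed

text \<open>A stream never accepts iff its head is rejected and its tail never accepts, so the
  probability of this event solves the first-step equation with \<open>c = 0\<close>.\<close>

lemma AE_eventually_accepted:
  assumes "acceptance_rate a b > 0"
  shows "AE \<omega> in stream_space (measure_pmf a). \<exists>n. b (\<omega> !! n)"
proof -
  let ?S = "stream_space (measure_pmf a)"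
  let ?N = "{\<omega> \<in> space ?S. \<forall>n. \<not> b (\<omega> !! n)}"
  interpret S: prob_space ?S
    by (rule prob_space.prob_space_stream_space) (rule prob_space_measure_pmf)
  have [measurable]: "?N \<in> sets ?S" by measurable
  have ind: "indicator ?N (x ## \<omega>) = (indicator {y. \<not> b y} x * indicator ?N \<omega> :: ennreal)" for x \<omega>
  proof -
    have "(\<forall>n. \<not> b ((x ## \<omega>) !! n)) \<longleftrightarrow> \<not> b x \<and> (\<forall>n. \<not> b (\<omega> !! n))"
      by (metis nat.exhaust snth.simps stream.sel)
    then show ?thesis by (simp add: indicator_def space_stream_space del: snth.simps)
  qed
  \<comment> \<open>The first proposal is independent of the tail, and the tail again has law
    \<open>?S\<close>.\<close>
  have "emeasure ?S ?N = (\<integral>\<^sup>+x. (\<integral>\<^sup>+\<omega>. indicator ?N (x ## \<omega>) \<partial>?S) \<partial>measure_pmf a)"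
    by (subst nn_integral_indicator[symmetric], simp)
      (subst prob_space.nn_integral_stream_space, auto intro: prob_space_measure_pmf)
  also have "\<dots> = emeasure (measure_pmf a) {y. \<not> b y} * emeasure ?S ?N"
    unfolding ind by (simp add: nn_integral_cmult nn_integral_multc)
  finally have "emeasure ?S ?N = 0 + ennreal (1 - acceptance_rate a b) * emeasure ?S ?N"
    by (simp add: emeasure_rejected)
  then have "ennreal (acceptance_rate a b) * emeasure ?S ?N = 0"
    by (rule first_step_fixpoint) (use assms acceptance_rate_le_1 S.measure_le_1 in auto)
  then have "emeasure ?S ?N = 0" using assms by auto
  then show ?thesis by (subst AE_iff_measurable[of ?N]) auto
qed

lemma pmf_rejection_sampler:
  fixes a :: "'a :: countable pmf"
  assumes "acceptance_rate a b > 0"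
  shows "pmf (rejection_sampler a b) y = pmf a y * of_bool (b y) / acceptance_rate a b"
proof -
  let ?S = "stream_space (measure_pmf a)"
  let ?Y = "rejection_output b -` {y} \<inter> space ?S"
  interpret S: prob_space ?S
    by (rule prob_space.prob_space_stream_space) (rule prob_space_measure_pmf)
  have [measurable]: "?Y \<in> sets ?S"
    by (rule measurable_sets[OF measurable_rejection_output]) simp
  \<comment> \<open>An accepted head is itself the output; a rejected one hands the decision to the
    tail.\<close>
  have ind: "indicator ?Y (x ## \<omega>)
      = (indicator {z. z = y \<and> b y} x + indicator {z. \<not> b z} x * indicator ?Y \<omega> :: ennreal)"
    if "\<exists>n. b (\<omega> !! n)" for x \<omega>
    using that by (cases "b x")
      (auto simp: indicator_def space_stream_space rejection_output_accept rejection_output_reject)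
  have "emeasure ?S ?Y = (\<integral>\<^sup>+x. (\<integral>\<^sup>+\<omega>. indicator ?Y (x ## \<omega>) \<partial>?S) \<partial>measure_pmf a)"
    by (subst nn_integral_indicator[symmetric], simp)
      (subst prob_space.nn_integral_stream_space, auto intro: prob_space_measure_pmf)
  also have "\<dots> = (\<integral>\<^sup>+x. (\<integral>\<^sup>+\<omega>. indicator {z. z = y \<and> b y} x
      + indicator {z. \<not> b z} x * indicator ?Y \<omega> \<partial>?S) \<partial>measure_pmf a)"
  \<comment> \<open>The decomposition \<open>ind\<close> can fail only for tails without an accepted
    sample, a null set.\<close>
  proof (rule nn_integral_cong, rule nn_integral_cong_AE)
    fix x
    show "AE \<omega> in ?S. indicator ?Y (x ## \<omega>)
      = (indicator {z. z = y \<and> b y} x + indicator {z. \<not> b z} x * indicator ?Y \<omega> :: ennreal)"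
      using AE_eventually_accepted[OF assms] by (rule eventually_mono) (rule ind)
  qed
  also have "\<dots> = emeasure (measure_pmf a) {z. z = y \<and> b y}
      + emeasure (measure_pmf a) {z. \<not> b z} * emeasure ?S ?Y"
    by (simp add: nn_integral_add nn_integral_cmult nn_integral_multc S.emeasure_space_1)
  also have "emeasure (measure_pmf a) {z. z = y \<and> b y} = ennreal (pmf a y * of_bool (b y))"
    by (auto simp: emeasure_pmf_single)
  finally have "ennreal (acceptance_rate a b) * emeasure ?S ?Y = ennreal (pmf a y * of_bool (b y))"
    unfolding emeasure_rejected
    by (rule first_step_fixpoint) (use assms acceptance_rate_le_1 S.measure_le_1 in auto)
  moreover have "emeasure ?S ?Y = ennreal (pmf (rejection_sampler a b) y)"
    by (simp add: emeasure_pmf_single[symmetric] measure_pmf_rejection_sampler emeasure_distr)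
  ultimately have "acceptance_rate a b * pmf (rejection_sampler a b) y = pmf a y * of_bool (b y)"
    using assms by (simp add: ennreal_mult[symmetric])
  then show ?thesis using assms by (simp add: field_simps)
qed

lemma kl_div_self: "kl_div p p = 0"
proof -
  \<comment> \<open>Off the support this rests on the conventions \<open>0 / 0 = 0\<close> and
    \<open>ln 0 = 0\<close>.\<close>
  have "ln (pmf p y / pmf p y) = 0" for y by (cases "pmf p y = 0") auto
  then show ?thesis by (simp add: kl_div_def)
qed

text \<open>The log-ratios differ by \<open>c\<close> wherever \<open>p\<close> has mass. The
  relation between \<open>r\<close> and \<open>q\<close> is asked for only there, because
  \<open>g'\<close> is a multiple of \<open>a'\<close> only where \<open>b\<close> holds.\<close>

lemma kl_div_rescale:
  assumes "c \<ge> 0" and r: "\<And>y. y \<in> set_pmf p \<Longrightarrow> pmf r y = exp c * pmf q y"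
  shows "kl_div p q = kl_div p r + ereal c"
proof (cases "\<exists>y. pmf p y > 0 \<and> pmf q y = 0")
  case True
  then obtain y where y: "pmf p y > 0" "pmf q y = 0" by blast
  then have "pmf r y = 0" using r[of y] by (auto simp: set_pmf_iff)
  then show ?thesis using y unfolding kl_div_def by auto
next
  case False
  let ?L = "\<lambda>q y. ln (pmf p y / pmf q y)"
  let ?P = "\<lambda>q. \<integral>\<^sup>+y. ennreal (?L q y) \<partial>measure_pmf p"
  let ?N = "\<lambda>q. \<integral>\<^sup>+y. ennreal (- ?L q y) \<partial>measure_pmf p"
  have False': "\<not> (\<exists>y. pmf p y > 0 \<and> pmf r y = 0)"
    using False r by (auto simp: set_pmf_iff)
  \<comment> \<open>This is \<open>?L q y = ?L r y + c\<close> split into positive and negative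
    parts, with the negative parts moved across so that only nonnegative terms are added.\<close>
  have pt: "ennreal (?L q y) + ennreal (- ?L r y) = ennreal (?L r y) + ennreal (- ?L q y) + ennreal c"
    if "y \<in> set_pmf p" for y
  proof -
    have pos: "pmf p y > 0" "pmf q y > 0"
      using pmf_positive[OF that] False by (auto simp: less_le)
    then have L: "?L q y = ?L r y + c"
      using r[OF that] by (simp add: ln_div ln_mult)
    have "max 0 (?L q y) + max 0 (- ?L r y) = max 0 (?L r y) + max 0 (- ?L q y) + c"
      unfolding L by linarith
    from arg_cong[OF this, of ennreal] show ?thesis
      using \<open>c \<ge> 0\<close> by (simp add: ennreal_plus)
  qed
  have sum: "?P q + ?N r = ?P r + ?N q + ennreal c"
  proof -
    have "?P q + ?N r = (\<integral>\<^sup>+y. ennreal (?L q y) + ennreal (- ?L r y) \<partial>measure_pmf p)"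
      by (subst nn_integral_add) auto
    also have "\<dots> = (\<integral>\<^sup>+y. ennreal (?L r y) + ennreal (- ?L q y) + ennreal c \<partial>measure_pmf p)"
      using pt by (intro nn_integral_cong_AE) (auto simp: AE_measure_pmf_iff)
    also have "\<dots> = ?P r + ?N q + ennreal c"
      by (simp add: nn_integral_add)
    finally show ?thesis .
  qed
  \<comment> \<open>Finite negative parts can be moved back by subtraction even when the positive
    parts are infinite.\<close>
  have "?N q \<le> 1" "?N r \<le> 1"
    using False False' by (auto intro!: kl_div_neg_part_le_1)
  then obtain m n where mn: "?N q = ennreal m" "m \<ge> 0" "?N r = ennreal n" "n \<ge> 0"
    by (cases "?N q"; cases "?N r") (auto simp: top_unique)
  have "enn2ereal (?P q) - ereal m = enn2ereal (?P r) - ereal n + ereal c"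
    using sum[unfolded mn] mn(2,4) \<open>c \<ge> 0\<close>
    by (cases "?P q"; cases "?P r")
      (auto simp: enn2ereal_ennreal ennreal_plus[symmetric] simp del: ennreal_plus)
  then show ?thesis
    using False False' mn unfolding kl_div_def by (auto simp: enn2ereal_ennreal)
qed

theorem theorem2:
  fixes a a' g g' :: "'v :: finite list pmf" and b :: "'v list \<Rightarrow> bool"
  assumes "autoregressive a" and "autoregressive a'"
    and "gold_normalizer a b > 0"
    and "\<exists>y. pmf a' y > 0 \<and> b y"
  defines "g \<equiv> gold_model a b"
    and "g' \<equiv> rejection_sampler a' b"
  shows "kl_div g a' = kl_div g g' + kl_div g' a' \<and>
         kl_div g g' + kl_div g' a' = kl_div g g' - ereal (ln (acceptance_rate a' b))"
proof -
  let ?A = "acceptance_rate a' b"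
  obtain y where "pmf a' y > 0" "b y" using assms(4) by blast
  then have A: "0 < ?A" by (rule acceptance_rate_pos)
  have c: "- ln ?A \<ge> 0" using A acceptance_rate_le_1[of a' b] by simp
  have g': "pmf g' y = pmf a' y * of_bool (b y) / ?A" for y
    unfolding g'_def by (rule pmf_rejection_sampler) (rule A)
  \<comment> \<open>Where \<open>b\<close> holds, \<open>g'\<close> is \<open>a'\<close> divided by
    \<open>?A\<close>, so the shift is \<open>c = - ln ?A\<close>.\<close>
  have rescale: "pmf g' y = exp (- ln ?A) * pmf a' y" if "b y" for y
    using that A by (simp add: g' exp_minus divide_inverse mult.commute)
  have "b y" if "y \<in> set_pmf g" for y
    using that by (simp add: set_pmf_iff g_def pmf_gold_model[OF assms(3)])
  then have 1: "kl_div g a' = kl_div g g' + ereal (- ln ?A)"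
    by (rule kl_div_rescale[OF c rescale])
  have "b y" if "y \<in> set_pmf g'" for y
    using that by (simp add: set_pmf_iff g')
  then have "kl_div g' a' = kl_div g' g' + ereal (- ln ?A)"
    by (rule kl_div_rescale[OF c rescale])
  then have 2: "kl_div g' a' = ereal (- ln ?A)" by (simp add: kl_div_self)
  \<comment> \<open>Here \<open>x\<close> may be infinite, as \<open>kl_div g g'\<close> can
    be.\<close>
  have "x + ereal (- ln ?A) = x - ereal (ln ?A)" for x
    by (simp add: minus_ereal_def)
  then show ?thesis using 1 2 by simp
qed

end
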